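(* Let $W\ge 2$ be an integer, let $\phi_1\in\mathbb{R}$, $\phi_1\ne 0$, and let $\mathbf{W}=(w_{i,j})_{i,j=0}^{W}$ be the symmetric tridiagonal real matrix with $w_{0,0}=w_{W,W}=1$, $w_{i,i}=1+\phi_1^2$ for $1\le i\le W-1$, $w_{i,i+1}=w_{i+1,i}=-\phi_1$ for $0\le i\le W-1$, and $w_{i,j}=0$ for $|i-j|>1$. There exist integers $A,B\ge 1$ and symmetric real matrices $\mathbf{A}=(a_{i,j})_{i,j=0}^{A}$ and $\mathbf{B}=(b_{i,j})_{i,j=0}^{B}$ such that $\mathbf{W}=\mathbf{A}\ast\mathbf{B}$ if and only if $|\phi_1|=1$.
   Context: Matrix convolution: for $\mathbf{A}=(a_{i,j})_{i,j=0}^{A}$ and $\mathbf{B}=(b_{i,j})_{i,j=0}^{B}$ the matrix $\mathbf{C}=\mathbf{A}\ast\mathbf{B}=(c_{i,j})_{i,j=0}^{A+B}$ has entries $c_{i,j}=\sum_{k,l}a_{k,l}\,b_{i-k,j-l}$, the sum being over all $k,l$ with $\max\{0,i-B\}\le k\le\min\{A,i\}$, $\max\{0,j-B\}\le l\le\min\{A,j\}$. In particular $\mathbf{W}=\mathbf{A}\ast\mathbf{B}$ requires $W=A+B$. For $|\phi_1|<1$ the matrix $\mathbf{W}$ is the inverse of the autocovariance matrix of $W+1$ consecutive values of the stationary AR(1) process with coefficient $\phi_1$. *)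

theory Defs
  imports Complex_Main "Jordan_Normal_Form.Matrix"
begin

(* An (n+1) x (n+1) matrix with indices 0..n is an element of carrier_mat (n+1) (n+1), so the
   largest index is the dimension minus one. Both arguments are meant to be square and nonempty.
   Subtraction on nat truncates, so i - b below is max {0, i - b}. *)
definition mat_conv :: "'a::comm_semiring_0 mat \<Rightarrow> 'a mat \<Rightarrow> 'a mat"  (infixl \<open>\<star>\<close> 70) where
  "M \<star> N = (let a = dim_row M - 1; b = dim_row N - 1 in
     mat (a + b + 1) (a + b + 1)
       (\<lambda>(i, j). \<Sum>k = i - b..min a i. \<Sum>l = j - b..min a j.
          M $$ (k, l) * N $$ (i - k, j - l)))"

definition ar1_mat :: "nat \<Rightarrow> real \<Rightarrow> real mat" where
  "ar1_mat W \<phi> = mat (W + 1) (W + 1)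
     (\<lambda>(i, j). if i = j then (if i = 0 \<or> i = W then 1 else 1 + \<phi>\<^sup>2)
               else if j = i + 1 \<or> i = j + 1 then - \<phi>
               else 0)"

end

theory Submission
  imports Defs "HOL-Computational_Algebra.Polynomial"
begin

text \<open>
  Read a square matrix as a bivariate polynomial in \<open>x\<close>, \<open>y\<close>, so that convolution becomes
  multiplication, and put \<open>t = x y\<close>. The matrix of the theorem is
  \<open>R(t) - \<phi> (x + y) S(t)\<close> with \<open>S = 1 + t + \<dots> + t\<^bsup>W-1\<^esup>\<close> and
  \<open>R = (1 + \<phi>\<^sup>2) S + t\<^bsup>W\<^esup> - \<phi>\<^sup>2\<close>. Being tridiagonal, it can only be a product of a symmetric
  tridiagonal and a diagonal factor \<open>\<alpha>(t)\<close>, and \<open>\<alpha>\<close> divides both \<open>S\<close> and \<open>R\<close>, hence \<open>1 - \<phi>\<^sup>2\<close>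
  because \<open>t\<^bsup>W\<^esup> \<equiv> 1\<close> modulo \<open>S\<close>. For \<open>\<phi>\<^sup>2 = 1\<close> one has \<open>R = (1 + t) S\<close>, and \<open>S\<close> splits off.
\<close>

text \<open>
  With \<open>a\<close> the largest index, the entry at \<open>(k, l)\<close> is attached to \<open>z\<^bsup>k - l + a\<^esup> t\<^bsup>l\<^esup>\<close>
  (\<open>z\<close> outer, \<open>t\<close> inner variable), so each power of \<open>z\<close> collects one diagonal; the shift by \<open>a\<close>
  keeps the exponents nonnegative.
\<close>

definition diag_poly :: "'a::comm_semiring_0 mat \<Rightarrow> 'a poly poly" where
  "diag_poly M = (let a = dim_row M - 1 in
     \<Sum>k\<le>a. \<Sum>l\<le>a. monom (monom (M $$ (k, l)) l) (k + (a - l)))"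

text \<open>The bounds on \<open>k\<close> say exactly that \<open>k\<close> \<le> \<open>a\<close>
  and \<open>i - k\<close> \<le> \<open>b\<close>, so \<open>i = k + m\<close> is a bijective change
  of indices.\<close>

lemma sum_convolution_index:
  fixes f :: "nat \<Rightarrow> nat \<Rightarrow> 'b::comm_monoid_add"
  shows "(\<Sum>i\<le>a + b. \<Sum>k = i - b..min a i. f k (i - k)) = (\<Sum>k\<le>a. \<Sum>m\<le>b. f k m)"
proof -
  have "(\<Sum>i\<le>a + b. \<Sum>k = i - b..min a i. f k (i - k))
      = (\<Sum>(i, k)\<in>(SIGMA i:{..a + b}. {i - b..min a i}). f k (i - k))"
    by (rule sum.Sigma) auto
  also have "\<dots> = (\<Sum>(k, m)\<in>{..a} \<times> {..b}. f k m)"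
    by (rule sum.reindex_bij_witness[where i = "\<lambda>(k, m). (k + m, k)" and j = "\<lambda>(i, k). (k, i - k)"])
       auto
  also have "\<dots> = (\<Sum>k\<le>a. \<Sum>m\<le>b. f k m)"
    by (rule sum.cartesian_product[symmetric])
  finally show ?thesis .
qed

text \<open>The shifts add up: for \<open>l\<close> \<le> \<open>a\<close> and \<open>l'\<close>
  \<le> \<open>b\<close> the exponents \<open>k + (a - l)\<close> and \<open>k' + (b - l')\<close>
  sum to \<open>k + k' + (a + b - (l + l'))\<close>, the one belonging to largest index
  \<open>a + b\<close>.\<close>

lemma diag_poly_conv:
  assumes M: "M \<in> carrier_mat (a + 1) (a + 1)" and N: "N \<in> carrier_mat (b + 1) (b + 1)"
  shows "diag_poly (M \<star> N) = diag_poly M * diag_poly N"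
proof -
  let ?m = "\<lambda>c l e. monom (monom c l) e"
  define f where "f k k' l l' =
    ?m (M $$ (k, l) * N $$ (k', l')) (l + l') (k + k' + (a + b - (l + l')))" for k k' l l'
  have dims: "dim_row M = a + 1" "dim_row N = b + 1" using M N by auto
  have "diag_poly (M \<star> N) = (\<Sum>i\<le>a + b. \<Sum>j\<le>a + b. \<Sum>k = i - b..min a i. \<Sum>l = j - b..min a j.
      ?m (M $$ (k, l) * N $$ (i - k, j - l)) j (i + (a + b - j)))"
    unfolding diag_poly_def mat_conv_def Let_def using dims
    by (simp flip: monom_sum)
  also have "\<dots> = (\<Sum>i\<le>a + b. \<Sum>k = i - b..min a i. \<Sum>j\<le>a + b. \<Sum>l = j - b..min a j.
      f k (i - k) l (j - l))"
    by (subst sum.swap, intro sum.cong refl) (auto simp: f_def)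
  also have "\<dots> = (\<Sum>k\<le>a. \<Sum>k'\<le>b. \<Sum>l\<le>a. \<Sum>l'\<le>b. f k k' l l')"
    by (simp only: sum_convolution_index
        sum_convolution_index[where f = "\<lambda>k k'. \<Sum>l\<le>a. \<Sum>l'\<le>b. f k k' l l'"])
  also have "\<dots> = (\<Sum>k\<le>a. \<Sum>k'\<le>b. \<Sum>l\<le>a. \<Sum>l'\<le>b.
      ?m (M $$ (k, l)) l (k + (a - l)) * ?m (N $$ (k', l')) l' (k' + (b - l')))"
    unfolding f_def mult_monom
    by (intro sum.cong refl arg_cong2[where f = monom]) auto
  also have "\<dots> = diag_poly M * diag_poly N"
    unfolding diag_poly_def Let_def using dims
    by (simp add: sum_product)
  finally show ?thesis .
qed

lemma coeff_diag_poly: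
  assumes M: "M \<in> carrier_mat (a + 1) (a + 1)"
  shows "coeff (coeff (diag_poly M) n) l =
    (if l \<le> a \<and> a \<le> n + l \<and> n + l \<le> 2 * a then M $$ (n + l - a, l) else 0)"
proof -
  have "coeff (coeff (diag_poly M) n) l =
      (\<Sum>k\<le>a. \<Sum>j\<le>a. if j = l then (if k + (a - j) = n then M $$ (k, j) else 0) else 0)"
    unfolding diag_poly_def Let_def coeff_sum using M
    by (intro sum.cong) auto
  also have "\<dots> = (\<Sum>k\<le>a. if k = n + l - a then
      (if l \<le> a \<and> a \<le> n + l then M $$ (k, l) else 0) else 0)"
    by (intro sum.cong refl) (auto simp: sum.delta)
  also have "\<dots> = (if l \<le> a \<and> a \<le> n + l \<and> n + l \<le> 2 * a then M $$ (n + l - a, l) else 0)"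
    by (auto simp: sum.delta)
  finally show ?thesis .
qed

text \<open>Transposition swaps the diagonals at \<open>n\<close> and \<open>2 * a - n\<close>. The
  degree bound kills those below the main diagonal, symmetry then those above it.\<close>

lemma coeff_diag_poly_symmetric:
  assumes M: "M \<in> carrier_mat (a + 1) (a + 1)" and sym: "transpose_mat M = M"
    and deg: "degree (diag_poly M) \<le> a" and n: "n \<noteq> a"
  shows "coeff (diag_poly M) n = 0"
proof (cases "n > a")
  case True
  then show ?thesis using deg by (simp add: coeff_eq_0)
next
  case False
  have "coeff (coeff (diag_poly M) n) l = 0" for l
  proof (cases "l \<le> a \<and> a \<le> n + l")
    case True
    have idx: "2 * a - n + (n + l - a) = a + l" "n + l - a \<le> a" using True False by auto
    have "degree (diag_poly M) < 2 * a - n" using deg n False by simp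
    then have "coeff (coeff (diag_poly M) (2 * a - n)) (n + l - a) = 0"
      by (simp add: coeff_eq_0)
    then have "M $$ (l, n + l - a) = 0"
      using True False idx by (simp add: coeff_diag_poly[OF M])
    moreover have "M $$ (n + l - a, l) = M $$ (l, n + l - a)"
      using index_transpose_mat(1)[of "n + l - a" M l] M True idx unfolding sym by simp
    ultimately show ?thesis by (simp add: coeff_diag_poly[OF M])
  qed (auto simp: coeff_diag_poly[OF M])
  then show ?thesis by (simp add: poly_eq_iff)
qed

text \<open>Otherwise the leading coefficient would sit off the main diagonal and vanish.\<close>

lemma degree_diag_poly_ge:
  assumes M: "M \<in> carrier_mat (a + 1) (a + 1)" and sym: "transpose_mat M = M"
    and nz: "diag_poly M \<noteq> 0"
  shows "a \<le> degree (diag_poly M)"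
proof (rule ccontr)
  assume "\<not> a \<le> degree (diag_poly M)"
  then have "coeff (diag_poly M) (degree (diag_poly M)) = 0"
    using coeff_diag_poly_symmetric[OF M sym] by simp
  then show False using nz by simp
qed

lemma diag_poly_diagonal:
  assumes "M \<in> carrier_mat (a + 1) (a + 1)" "transpose_mat M = M" "degree (diag_poly M) = a"
  shows "diag_poly M = monom (coeff (diag_poly M) a) a"
  using coeff_diag_poly_symmetric[OF assms(1,2)] assms(3) by (auto simp: poly_eq_iff)

lemma ar1_mat_carrier: "ar1_mat W \<phi> \<in> carrier_mat (W + 1) (W + 1)"
  by (simp add: ar1_mat_def)

lemma coeff_diag_poly_ar1:
  "coeff (coeff (diag_poly (ar1_mat W \<phi>)) n) l =
    (if l \<le> W \<and> W \<le> n + l \<and> n + l \<le> 2 * W then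
       if n = W then (if l = 0 \<or> l = W then 1 else 1 + \<phi>\<^sup>2)
       else if n = W + 1 \<or> W = n + 1 then - \<phi> else 0
     else 0)"
  unfolding coeff_diag_poly[OF ar1_mat_carrier] by (auto simp: ar1_mat_def)

lemma coeff_diag_poly_ar1_main:
  assumes "W \<ge> 1"
  shows "coeff (diag_poly (ar1_mat W \<phi>)) W =
    smult (1 + \<phi>\<^sup>2) (\<Sum>i<W. monom 1 i) + monom 1 W - [:\<phi>\<^sup>2:]"
proof (rule poly_eqI)
  fix l
  have "coeff [:\<phi>\<^sup>2:] l = (if l = 0 then \<phi>\<^sup>2 else 0)"
    by (cases l) auto
  then show "coeff (coeff (diag_poly (ar1_mat W \<phi>)) W) l =
      coeff (smult (1 + \<phi>\<^sup>2) (\<Sum>i<W. monom 1 i) + monom 1 W - [:\<phi>\<^sup>2:]) l"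
    using assms by (simp add: coeff_diag_poly_ar1 coeff_sum)
qed

lemma coeff_diag_poly_ar1_sub:
  "coeff (diag_poly (ar1_mat W \<phi>)) (W + 1) = smult (- \<phi>) (\<Sum>i<W. monom 1 i)"
  by (auto simp: poly_eq_iff coeff_diag_poly_ar1 coeff_sum)

lemma degree_diag_poly_ar1:
  assumes "W \<ge> 1" "\<phi> \<noteq> 0"
  shows "degree (diag_poly (ar1_mat W \<phi>)) = W + 1"
proof (rule antisym)
  show "degree (diag_poly (ar1_mat W \<phi>)) \<le> W + 1"
    by (rule degree_le)
       (auto simp: poly_eq_iff coeff_diag_poly_ar1)
  have "coeff (coeff (diag_poly (ar1_mat W \<phi>)) (W + 1)) 0 \<noteq> 0"
    using assms by (simp add: coeff_diag_poly_ar1)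
  then show "W + 1 \<le> degree (diag_poly (ar1_mat W \<phi>))"
    by (intro le_degree) auto
qed

lemma common_divisor_dvd_const:
  fixes \<alpha> :: "real poly" and \<phi> :: real
  defines "S W \<equiv> (\<Sum>i<W. monom (1::real) i)"
  assumes "\<phi> \<noteq> 0" and "\<alpha> dvd smult (- \<phi>) (S W)"
    and R: "\<alpha> dvd smult (1 + \<phi>\<^sup>2) (S W) + monom 1 W - [:\<phi>\<^sup>2:]"
  shows "\<alpha> dvd [:1 - \<phi>\<^sup>2:]"
proof -
  have S: "\<alpha> dvd S W" using assms by (simp add: dvd_smult_iff)
  \<comment> \<open>This rewrites against the direction of \<open>add_pCons\<close>, which is
    therefore removed from the simp set in the induction.\<close>
  have pCons_add_0: "pCons 0 (p + q) = pCons 0 p + pCons 0 q" for p q :: "real poly"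
    by simp
  have "[:-1, 1:] * S W = monom 1 W - 1"
    unfolding S_def
    by (induction W) (auto simp: algebra_simps monom_Suc pCons_add_0 simp del: add_pCons)
  then have "[:1 - \<phi>\<^sup>2:] = (smult (1 + \<phi>\<^sup>2) (S W) + monom 1 W - [:\<phi>\<^sup>2:])
      - (smult (1 + \<phi>\<^sup>2) (S W) + [:-1, 1:] * S W)"
    by (simp add: one_pCons)
  moreover have "\<alpha> dvd smult (1 + \<phi>\<^sup>2) (S W) + [:-1, 1:] * S W"
    using S by (intro dvd_add dvd_smult dvd_mult)
  ultimately show ?thesis using R by (simp only: dvd_diff)
qed

lemma no_diagonal_factor:
  assumes M: "M \<in> carrier_mat (a + 1) (a + 1)" and N: "N \<in> carrier_mat (b + 1) (b + 1)"
    and sym: "transpose_mat M = M" and deg: "degree (diag_poly M) = a"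
    and a: "a \<ge> 1" and \<phi>: "\<phi> \<noteq> 0"
    and eq: "diag_poly (ar1_mat (a + b) \<phi>) = diag_poly M * diag_poly N"
  shows "\<phi>\<^sup>2 = 1"
proof (rule ccontr)
  assume "\<phi>\<^sup>2 \<noteq> 1"
  define \<alpha> where "\<alpha> = coeff (diag_poly M) a"
  define \<beta> where "\<beta> = coeff (diag_poly N) b"
  have "diag_poly (ar1_mat (a + b) \<phi>) = monom \<alpha> a * diag_poly N"
    using diag_poly_diagonal[OF M sym deg] eq by (simp add: \<alpha>_def)
  then have prod: "coeff (diag_poly (ar1_mat (a + b) \<phi>)) (a + n) = \<alpha> * coeff (diag_poly N) n" for n
    by (simp add: coeff_monom_mult)
  have "\<alpha> dvd [:1 - \<phi>\<^sup>2:]"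
  proof (rule common_divisor_dvd_const[OF \<phi>])
    show "\<alpha> dvd smult (- \<phi>) (\<Sum>i<a + b. monom 1 i)"
      using coeff_diag_poly_ar1_sub[of "a + b" \<phi>] prod[of "b + 1"]
      by (metis add.assoc dvd_triv_left)
    show "\<alpha> dvd smult (1 + \<phi>\<^sup>2) (\<Sum>i<a + b. monom 1 i) + monom 1 (a + b) - [:\<phi>\<^sup>2:]"
      using coeff_diag_poly_ar1_main[of "a + b" \<phi>] prod[of b] a
      by (metis dvd_triv_left trans_le_add1)
  qed
  then have "degree \<alpha> = 0"
    using dvd_imp_degree_le[of \<alpha> "[:1 - \<phi>\<^sup>2:]"] \<open>\<phi>\<^sup>2 \<noteq> 1\<close> by simp
  then obtain c where c: "\<alpha> = [:c:]" by (rule degree_eq_zeroE)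
  \<comment> \<open>With \<alpha> constant, \<alpha>\<beta> has degree at most
    \<open>b < a + b\<close> in \<open>t\<close>, yet the corner entry of the product at
    \<open>t\<close> to the power \<open>a + b\<close> is 1.\<close>
  have "coeff (coeff (diag_poly (ar1_mat (a + b) \<phi>)) (a + b)) (a + b) = 1"
    by (simp add: coeff_diag_poly_ar1)
  moreover have "coeff (\<alpha> * \<beta>) (a + b) = 0"
    using a by (simp add: c \<beta>_def coeff_diag_poly[OF N])
  ultimately show False using prod[of b] by (simp add: \<beta>_def)
qed

lemma ar1_mat_not_conv:
  assumes M: "M \<in> carrier_mat (a + 1) (a + 1)" and N: "N \<in> carrier_mat (b + 1) (b + 1)"
    and symM: "transpose_mat M = M" and symN: "transpose_mat N = N"
    and ab: "a \<ge> 1" "b \<ge> 1" and \<phi>: "\<phi> \<noteq> 0" and eq: "ar1_mat W \<phi> = M \<star> N"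
  shows "\<phi>\<^sup>2 = 1"
proof -
  have "W + 1 = dim_row (M \<star> N)" using eq[symmetric] by (simp add: ar1_mat_def)
  then have W: "W = a + b" using M N by (simp add: mat_conv_def Let_def)
  have prod: "diag_poly (ar1_mat (a + b) \<phi>) = diag_poly M * diag_poly N"
    using diag_poly_conv[OF M N] eq W by simp
  have deg: "degree (diag_poly (ar1_mat (a + b) \<phi>)) = a + b + 1"
    using ab \<phi> by (intro degree_diag_poly_ar1) auto
  then have nz: "diag_poly M \<noteq> 0" "diag_poly N \<noteq> 0" using prod by auto
  then have "degree (diag_poly M) + degree (diag_poly N) = a + b + 1"
    using deg by (simp add: prod degree_mult_eq)
  \<comment> \<open>The degrees are at least \<open>a\<close> and \<open>b\<close> and exceed
    \<open>a + b\<close> by only one in total, so one of them is minimal and that factor is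
    diagonal.\<close>
  then consider "degree (diag_poly M) = a" | "degree (diag_poly N) = b"
    using degree_diag_poly_ge[OF M symM] degree_diag_poly_ge[OF N symN] nz by linarith
  then show ?thesis
  proof cases
    case 1
    then show ?thesis using no_diagonal_factor[OF M N symM _ ab(1) \<phi> prod] by simp
  next
    case 2
    then show ?thesis
      using no_diagonal_factor[OF N M symN _ ab(2) \<phi>] prod by (simp add: ac_simps)
  qed
qed

text \<open>The identity stands for \<open>S(t)\<close> and the second factor for
  \<open>1 + t - \<phi> (x + y)\<close>. The entries are checked directly by counting
  overlaps.\<close>

lemma ar1_mat_conv:
  assumes W: "W \<ge> 1" and \<phi>: "\<phi>\<^sup>2 = 1"
  shows "ar1_mat W \<phi> = 1\<^sub>m W \<star> mat 2 2 (\<lambda>(i, j). if i = j then 1 else - \<phi>)"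
    (is "_ = _ \<star> ?N")
proof (rule eq_matI)
  fix i j
  assume "i < dim_row (1\<^sub>m W \<star> ?N)" and "j < dim_col (1\<^sub>m W \<star> ?N)"
  then have ij: "i \<le> W" "j \<le> W" using W by (auto simp: mat_conv_def Let_def)
  let ?I = "\<lambda>i. {i - 1..min (W - 1) i}"
  have "(1\<^sub>m W \<star> ?N) $$ (i, j) =
      (\<Sum>k\<in>?I i. \<Sum>l\<in>?I j. 1\<^sub>m W $$ (k, l) * ?N $$ (i - k, j - l))"
    using ij W unfolding mat_conv_def Let_def by simp
  also have "\<dots> = (\<Sum>k\<in>?I i. \<Sum>l\<in>?I j. if k = l then ?N $$ (i - k, j - l) else 0)"
    using W by (intro sum.cong refl) auto
  also have "\<dots> = (\<Sum>k\<in>?I i. if k \<in> ?I j then ?N $$ (i - k, j - k) else 0)"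
    by (intro sum.cong refl) (simp only: sum.delta' finite_atLeastAtMost)
  \<comment> \<open>Here \<open>i - k\<close> and \<open>j - k\<close> lie in {0, 1} and agree only
    for \<open>i = j\<close>.\<close>
  also have "\<dots> = (\<Sum>k\<in>?I i. if k \<in> ?I j then (if i = j then 1 else - \<phi>) else 0)"
    by (intro sum.cong refl) auto
  also have "\<dots> = real (card (?I i \<inter> ?I j)) * (if i = j then 1 else - \<phi>)"
    by (simp only: sum.inter_restrict[symmetric] finite_atLeastAtMost sum_constant)
  also have "?I i \<inter> ?I j = {max i j - 1..min (W - 1) (min i j)}"
    by (simp only: Int_atLeastAtMost) (auto simp: max_def min_def)
  \<comment> \<open>The interval has two elements at inner diagonal positions, where
    \<open>2 = 1 + \<phi>\<^sup>2\<close>, one at the two corners and next to the diagonal, and none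
    elsewhere.\<close>
  also have "real (card \<dots>) * (if i = j then 1 else - \<phi>) = ar1_mat W \<phi> $$ (i, j)"
    using ij W \<phi> by (auto simp: ar1_mat_def max_def min_def)
  finally show "ar1_mat W \<phi> $$ (i, j) = (1\<^sub>m W \<star> ?N) $$ (i, j)" ..
qed (use W in \<open>auto simp: ar1_mat_def mat_conv_def Let_def\<close>)

theorem theorem2:
  fixes W :: nat and \<phi> :: real
  assumes "W \<ge> 2" and "\<phi> \<noteq> 0"
  shows "(\<exists>a b. a \<ge> 1 \<and> b \<ge> 1 \<and>
            (\<exists>M \<in> carrier_mat (a + 1) (a + 1). \<exists>N \<in> carrier_mat (b + 1) (b + 1).
               transpose_mat M = M \<and> transpose_mat N = N \<and> ar1_mat W \<phi> = M \<star> N))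
         \<longleftrightarrow> \<bar>\<phi>\<bar> = 1"
    (is "?L \<longleftrightarrow> ?R")
proof
  assume ?L
  then show ?R using ar1_mat_not_conv assms(2) by (metis abs_square_eq_1)
next
  assume ?R
  then have "\<phi>\<^sup>2 = 1" by (simp add: abs_square_eq_1)
  let ?N = "mat 2 2 (\<lambda>(i, j). if i = j then 1 else - \<phi>)"
  have "ar1_mat W \<phi> = 1\<^sub>m W \<star> ?N"
    using assms \<open>\<phi>\<^sup>2 = 1\<close> by (intro ar1_mat_conv) auto
  moreover have "transpose_mat ?N = ?N" by (rule eq_matI) auto
  \<comment> \<open>The largest indices are \<open>W - 1\<close> and 1; the former is positive
    because \<open>W\<close> \<ge> 2.\<close>
  moreover have "1\<^sub>m W \<in> carrier_mat (W - 1 + 1) (W - 1 + 1)" "?N \<in> carrier_mat (1 + 1) (1 + 1)"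
    using assms by auto
  moreover have "W - 1 \<ge> 1" using assms by simp
  ultimately show ?L by (metis order_refl transpose_one)
qed

end
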